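(* Let $(X,\mathcal{B})$ be a bornological universe. The following statements are equivalent: (1) $(X,\mathcal{B})$ is Hausdorff and uniformizable; (2) $(X,\mathcal{B})$ is isomorphic to a subspace of a product of real lines.
   Context: A bornology on a set $X$ is a set $\mathcal{B}\subseteq 2^X$ such that $\{x\}\in\mathcal{B}$ for each $x\in X$; $B\in\mathcal{B}$ and $A\subseteq B$ imply $A\in\mathcal{B}$; and $A\cup B\in\mathcal{B}$ whenever $A,B\in\mathcal{B}$. Elements of $\mathcal{B}$ are called bounded sets. A bornological universe $(X,\mathcal{B})$ is a topological space $X$ endowed with a bornology $\mathcal{B}$ on its underlying set; it is Hausdorff if $X$ is Hausdorff. The morphisms are the continuous maps that send bounded sets to bounded sets; an isomorphism is a bijective morphism whose inverse is a morphism. A subset $B$ of a uniform space $(X,\mathcal{U})$ is bounded in the sense of Bourbaki if for each $U\in\mathcal{U}$ there are $n\in\mathbb{N}$ and a finite set $K\subseteq X$ with $B\subseteq U^n(K)$, where $U^n$ is the $n$-fold composition of $U$. $(X,\mathcal{B})$ is uniformizable (also called $bb$-uniformizable) if there is a uniformity $\mathcal{U}$ on $X$ whose underlying topology is the topology of $X$ and such that $\mathcal{B}$ is exactly the set of subsets of $X$ that are bounded in the sense of Bourbaki for $\mathcal{U}$. The real line is the bornological universe $\mathbb{R}$ with its usual topology and its usual bounded sets. A product of bornological universes $(X_i,\mathcal{B}_i)_{i\in I}$ carries the product topology and the bornology of all sets $B\subseteq\prod_{i\in I}X_i$ for which every projection $\pi_i(B)$ is in $\mathcal{B}_i$. A subspace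 $Y$ of a bornological universe carries the subspace topology and the bornology of all subsets of $Y$ that are bounded in the whole space. *)

theory Defs
  imports "HOL-Analysis.Analysis"
begin

subsection \<open>Bornological universes\<close>

definition bornology_on :: "'a set \<Rightarrow> 'a set set \<Rightarrow> bool" where
  "bornology_on S \<B> \<longleftrightarrow>
     \<B> \<subseteq> Pow S \<and>
     (\<forall>x\<in>S. {x} \<in> \<B>) \<and>
     (\<forall>B\<in>\<B>. \<forall>A. A \<subseteq> B \<longrightarrow> A \<in> \<B>) \<and>
     (\<forall>A\<in>\<B>. \<forall>B\<in>\<B>. A \<union> B \<in> \<B>)"

type_synonym 'a born_univ = "'a topology \<times> 'a set set"

definition bornological_universe :: "'a born_univ \<Rightarrow> bool" where
  "bornological_universe X \<longleftrightarrow> bornology_on (topspace (fst X)) (snd X)"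

definition born_morphism :: "'a born_univ \<Rightarrow> 'b born_univ \<Rightarrow> ('a \<Rightarrow> 'b) \<Rightarrow> bool" where
  "born_morphism X Y f \<longleftrightarrow>
     continuous_map (fst X) (fst Y) f \<and> (\<forall>B\<in>snd X. f ` B \<in> snd Y)"

definition born_isomorphism :: "'a born_univ \<Rightarrow> 'b born_univ \<Rightarrow> ('a \<Rightarrow> 'b) \<Rightarrow> bool" where
  "born_isomorphism X Y f \<longleftrightarrow>
     bij_betw f (topspace (fst X)) (topspace (fst Y)) \<and>
     born_morphism X Y f \<and>
     born_morphism Y X (inv_into (topspace (fst X)) f)"

definition born_isomorphic :: "'a born_univ \<Rightarrow> 'b born_univ \<Rightarrow> bool" where
  "born_isomorphic X Y \<longleftrightarrow> (\<exists>f. born_isomorphism X Y f)"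

definition born_real_line :: "real born_univ" where
  "born_real_line = (euclideanreal, {B. bounded B})"

definition born_product :: "'i set \<Rightarrow> ('i \<Rightarrow> 'a born_univ) \<Rightarrow> ('i \<Rightarrow> 'a) born_univ" where
  "born_product I X =
     (product_topology (\<lambda>i. fst (X i)) I,
      {B. B \<subseteq> (\<Pi>\<^sub>E i\<in>I. topspace (fst (X i))) \<and> (\<forall>i\<in>I. (\<lambda>x. x i) ` B \<in> snd (X i))})"

definition born_subspace :: "'a born_univ \<Rightarrow> 'a set \<Rightarrow> 'a born_univ" where
  "born_subspace X Y = (subtopology (fst X) Y, {B \<in> snd X. B \<subseteq> Y})"

lemma bornological_universe_real_line: "bornological_universe born_real_line"
  by (auto simp: bornological_universe_def bornology_on_def born_real_line_def
      intro: bounded_subset)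

lemma bornological_universe_product:
  fixes X :: "'i \<Rightarrow> 'a born_univ"
  assumes "\<And>i. i \<in> I \<Longrightarrow> bornological_universe (X i)"
  shows "bornological_universe (born_product I X)"
proof -
  have b: "bornology_on (topspace (fst (X i))) (snd (X i))" if "i \<in> I" for i
    using assms that by (simp add: bornological_universe_def)
  have sing: "{x i} \<in> snd (X i)"
    if "x \<in> (\<Pi>\<^sub>E i\<in>I. topspace (fst (X i)))" "i \<in> I" for x i
    using b[OF that(2)] that by (auto simp: bornology_on_def PiE_def Pi_def)
  have hered: "\<forall>B\<in>snd (X i). \<forall>A. A \<subseteq> B \<longrightarrow> A \<in> snd (X i)"
    and union: "\<forall>A\<in>snd (X i). \<forall>B\<in>snd (X i). A \<union> B \<in> snd (X i)" if "i \<in> I" for i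
    using b[OF that] unfolding bornology_on_def by - (elim conjE, assumption)+
  have sub: "(\<lambda>x. x i) ` A \<in> snd (X i)"
    if "A \<subseteq> B" "(\<lambda>x. x i) ` B \<in> snd (X i)" "i \<in> I" for A B :: "('i \<Rightarrow> 'a) set" and i
    using hered[OF that(3), rule_format, OF that(2) image_mono[OF that(1)]] .
  have un: "(\<lambda>x. x i) ` (A \<union> B) \<in> snd (X i)"
    if "(\<lambda>x. x i) ` A \<in> snd (X i)" "(\<lambda>x. x i) ` B \<in> snd (X i)" "i \<in> I"
    for A B :: "('i \<Rightarrow> 'a) set" and i
    using union[OF that(3), rule_format, OF that(1,2)] by (simp add: image_Un)
  show ?thesis
    unfolding bornological_universe_def born_product_def bornology_on_def fst_conv snd_conv
      topspace_product_topology o_def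
  proof (intro conjI ballI allI impI)
    fix x
    assume "x \<in> (\<Pi>\<^sub>E i\<in>I. topspace (fst (X i)))"
    then show "{x} \<in> {B. B \<subseteq> (\<Pi>\<^sub>E i\<in>I. topspace (fst (X i))) \<and>
        (\<forall>i\<in>I. (\<lambda>x. x i) ` B \<in> snd (X i))}"
      using sing by simp
  next
    fix A B
    assume "B \<in> {B. B \<subseteq> (\<Pi>\<^sub>E i\<in>I. topspace (fst (X i))) \<and>
        (\<forall>i\<in>I. (\<lambda>x. x i) ` B \<in> snd (X i))}" "A \<subseteq> B"
    then show "A \<in> {B. B \<subseteq> (\<Pi>\<^sub>E i\<in>I. topspace (fst (X i))) \<and>
        (\<forall>i\<in>I. (\<lambda>x. x i) ` B \<in> snd (X i))}"
      using sub[of A B] by auto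
  next
    fix A B
    assume "A \<in> {B. B \<subseteq> (\<Pi>\<^sub>E i\<in>I. topspace (fst (X i))) \<and>
        (\<forall>i\<in>I. (\<lambda>x. x i) ` B \<in> snd (X i))}"
      and "B \<in> {B. B \<subseteq> (\<Pi>\<^sub>E i\<in>I. topspace (fst (X i))) \<and>
        (\<forall>i\<in>I. (\<lambda>x. x i) ` B \<in> snd (X i))}"
    then show "A \<union> B \<in> {B. B \<subseteq> (\<Pi>\<^sub>E i\<in>I. topspace (fst (X i))) \<and>
        (\<forall>i\<in>I. (\<lambda>x. x i) ` B \<in> snd (X i))}"
      using un[of _ A B] by auto
  qed blast
qed

lemma bornological_universe_subspace:
  assumes "bornological_universe X" "Y \<subseteq> topspace (fst X)"
  shows "bornological_universe (born_subspace X Y)"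
  using assms
  by (auto simp: bornological_universe_def born_subspace_def bornology_on_def)


subsection \<open>Uniformities and boundedness in the sense of Bourbaki\<close>

text \<open>
  The type class \<open>uniform_space\<close> only covers uniformities on a whole type, so a
  uniformity on a carrier set is given here by its set of entourages. It is not required
  that the empty set is not an entourage: for a nonempty carrier this follows from
  reflexivity, and the empty carrier has the uniformity \<open>{{}}\<close>.
\<close>

definition uniformity_on :: "'a set \<Rightarrow> ('a \<times> 'a) set set \<Rightarrow> bool" where
  "uniformity_on S \<U> \<longleftrightarrow>
     \<U> \<noteq> {} \<and>
     (\<forall>U\<in>\<U>. U \<subseteq> S \<times> S \<and> Id_on S \<subseteq> U) \<and>
     (\<forall>U\<in>\<U>. \<forall>V. U \<subseteq> V \<and> V \<subseteq> S \<times> S \<longrightarrow> V \<in> \<U>) \<and>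
     (\<forall>U\<in>\<U>. \<forall>V\<in>\<U>. U \<inter> V \<in> \<U>) \<and>
     (\<forall>U\<in>\<U>. U\<inverse> \<in> \<U>) \<and>
     (\<forall>U\<in>\<U>. \<exists>V\<in>\<U>. V O V \<subseteq> U)"

definition uniform_topology :: "'a set \<Rightarrow> ('a \<times> 'a) set set \<Rightarrow> 'a topology" where
  "uniform_topology S \<U> =
     topology (\<lambda>A. A \<subseteq> S \<and> (\<forall>x\<in>A. \<exists>U\<in>\<U>. U `` {x} \<subseteq> A))"

lemma openin_uniform_topology:
  assumes "uniformity_on S \<U>"
  shows "openin (uniform_topology S \<U>) A \<longleftrightarrow>
           A \<subseteq> S \<and> (\<forall>x\<in>A. \<exists>U\<in>\<U>. U `` {x} \<subseteq> A)"
proof -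
  have "istopology (\<lambda>A. A \<subseteq> S \<and> (\<forall>x\<in>A. \<exists>U\<in>\<U>. U `` {x} \<subseteq> A))"
    unfolding istopology_def
  proof (intro conjI allI impI ballI)
    fix A B x
    assume A: "A \<subseteq> S \<and> (\<forall>x\<in>A. \<exists>U\<in>\<U>. U `` {x} \<subseteq> A)"
      and B: "B \<subseteq> S \<and> (\<forall>x\<in>B. \<exists>U\<in>\<U>. U `` {x} \<subseteq> B)"
      and x: "x \<in> A \<inter> B"
    have "x \<in> A" "x \<in> B"
      using x by auto
    then obtain U V where U: "U \<in> \<U>" "U `` {x} \<subseteq> A" and V: "V \<in> \<U>" "V `` {x} \<subseteq> B"
      using A B by metis
    have "\<forall>U\<in>\<U>. \<forall>V\<in>\<U>. U \<inter> V \<in> \<U>"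
      using assms unfolding uniformity_on_def by (elim conjE)
    then have "U \<inter> V \<in> \<U>"
      using U(1) V(1) by (elim ballE) auto
    moreover have "(U \<inter> V) `` {x} \<subseteq> A \<inter> B"
      using U(2) V(2) by auto
    ultimately show "\<exists>W\<in>\<U>. W `` {x} \<subseteq> A \<inter> B"
      by (rule rev_bexI)
  next
    fix \<K> x
    assume K: "\<forall>K\<in>\<K>. K \<subseteq> S \<and> (\<forall>x\<in>K. \<exists>U\<in>\<U>. U `` {x} \<subseteq> K)" and "x \<in> \<Union>\<K>"
    then obtain K where "K \<in> \<K>" "x \<in> K"
      by blast
    with K obtain U where "U \<in> \<U>" "U `` {x} \<subseteq> K"
      by metis
    with \<open>K \<in> \<K>\<close> show "\<exists>U\<in>\<U>. U `` {x} \<subseteq> \<Union>\<K>"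
      by (intro bexI[of _ U]) auto
  next
    fix A B :: "'a set"
    assume "A \<subseteq> S \<and> (\<forall>x\<in>A. \<exists>U\<in>\<U>. U `` {x} \<subseteq> A)"
    then show "A \<inter> B \<subseteq> S" by auto
  next
    fix \<K>
    assume "\<forall>K\<in>\<K>. K \<subseteq> S \<and> (\<forall>x\<in>K. \<exists>U\<in>\<U>. U `` {x} \<subseteq> K)"
    then show "\<Union>\<K> \<subseteq> S" by (simp add: Union_least)
  qed
  then show ?thesis
    by (simp add: uniform_topology_def topology_inverse')
qed

lemma topspace_uniform_topology:
  assumes "uniformity_on S \<U>"
  shows "topspace (uniform_topology S \<U>) = S"
proof -
  have "\<U> \<noteq> {}" and *: "\<forall>U\<in>\<U>. U \<subseteq> S \<times> S \<and> Id_on S \<subseteq> U"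
    using assms unfolding uniformity_on_def by - (elim conjE, assumption)+
  then obtain U where U: "U \<in> \<U>"
    by auto
  with * have "U \<subseteq> S \<times> S"
    by simp
  then have "U `` {x} \<subseteq> S" for x
    by auto
  with U have "openin (uniform_topology S \<U>) S"
    unfolding openin_uniform_topology[OF assms] by auto
  moreover have "topspace (uniform_topology S \<U>) \<subseteq> S"
    using openin_topspace[of "uniform_topology S \<U>"]
    unfolding openin_uniform_topology[OF assms] by simp
  ultimately show ?thesis
    by (simp add: openin_subset subset_antisym)
qed

definition bourbaki_bounded :: "'a set \<Rightarrow> ('a \<times> 'a) set set \<Rightarrow> 'a set \<Rightarrow> bool" where
  "bourbaki_bounded S \<U> B \<longleftrightarrow>
     B \<subseteq> S \<and> (\<forall>U\<in>\<U>. \<exists>n K. finite K \<and> K \<subseteq> S \<and> B \<subseteq> (U ^^ n) `` K)"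

definition uniformizable :: "'a born_univ \<Rightarrow> bool" where
  "uniformizable X \<longleftrightarrow>
     (\<exists>\<U>. uniformity_on (topspace (fst X)) \<U> \<and>
          uniform_topology (topspace (fst X)) \<U> = fst X \<and>
          snd X = {B. bourbaki_bounded (topspace (fst X)) \<U> B})"


subsection \<open>Subspaces of products of real lines\<close>

text \<open>
  The type argument is the type from which the index set of the product is taken; HOL has
  no existential quantifier over types. For a space with points in \<open>'a\<close>, index sets of type
  \<open>'a \<Rightarrow> real\<close> are general enough: coordinates that agree as functions on the space can be
  merged.
\<close>

definition iso_to_subspace_of_real_lines :: "'i itself \<Rightarrow> 'a born_univ \<Rightarrow> bool" where
  "iso_to_subspace_of_real_lines (_ :: 'i itself) X \<longleftrightarrow>
     (\<exists>(I :: 'i set) Y.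
        Y \<subseteq> topspace (fst (born_product I (\<lambda>_. born_real_line))) \<and>
        born_isomorphic X (born_subspace (born_product I (\<lambda>_. born_real_line)) Y))"

end

theory Submission
  imports Defs
begin

text \<open>
  A subspace of a product of real lines is, up to isomorphism, a universe described by real
  coordinates: a family of real functions that separates points, generates the topology, and is
  such that a set is bounded exactly when every function of the family is bounded on it
  (\<open>iso_to_subspace_iff_real_coordinates\<close>). The theorem thus says that a universe is Hausdorff and
  uniformizable iff it has real coordinates.

  Given coordinates, the coarsest uniformity that makes them uniformly continuous induces the
  topology. If every coordinate is bounded on a set, then cutting the ranges of finitely many of
  them into short intervals covers that set by finitely many small pieces, so the set is even
  totally bounded. Conversely, a uniformly continuous function is bounded on every Bourbaki
  bounded set, since it varies by less than \<open>1\<close> along each step of a suitable entourage.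

  Given a uniformity, all uniformly continuous real functions serve as coordinates. They generate
  the topology because points can be separated from complements of neighbourhoods
  (\<open>uniform_urysohn\<close>). The substantial point is that a set \<open>B\<close> which is not Bourbaki bounded carries
  an unbounded uniformly continuous function (\<open>unbounded_uniformly_continuous_function\<close>, a theorem
  of Hejcman). Let \<open>U\<close> be a symmetric entourage for which \<open>B\<close> is in no \<open>U\<^sup>n(K)\<close> with \<open>K\<close> finite.
  Either \<open>B\<close> meets infinitely many \<open>U\<close>-chain components, which can be numbered, or the number of
  \<open>U\<close>-steps from a finite set is unbounded on \<open>B\<close>. Both give an integer function \<open>g\<close> which is unbounded
  on \<open>B\<close> and changes by at most \<open>1\<close> along \<open>U\<close>. Replacing its jumps by Urysohn functions of the
  sublevel sets of \<open>g\<close> moves \<open>g\<close> by at most \<open>1\<close> and makes it uniformly continuous; here the Urysohn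
  functions need a modulus of continuity that does not depend on the set.
\<close>

section \<open>Uniformities\<close>

lemma uniformity_onD:
  assumes "uniformity_on S \<U>"
  shows uniformity_nonempty: "\<U> \<noteq> {}"
    and entourage_subset: "\<And>U. U \<in> \<U> \<Longrightarrow> U \<subseteq> S \<times> S"
    and entourage_refl: "\<And>U x. U \<in> \<U> \<Longrightarrow> x \<in> S \<Longrightarrow> (x, x) \<in> U"
    and entourage_mono: "\<And>U V. U \<in> \<U> \<Longrightarrow> U \<subseteq> V \<Longrightarrow> V \<subseteq> S \<times> S \<Longrightarrow> V \<in> \<U>"
    and entourage_Int: "\<And>U V. U \<in> \<U> \<Longrightarrow> V \<in> \<U> \<Longrightarrow> U \<inter> V \<in> \<U>"
    and entourage_converse: "\<And>U. U \<in> \<U> \<Longrightarrow> U\<inverse> \<in> \<U>"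
    and entourage_half: "\<And>U. U \<in> \<U> \<Longrightarrow> \<exists>V\<in>\<U>. V O V \<subseteq> U"
proof -
  note D = assms[unfolded uniformity_on_def]
  show "\<U> \<noteq> {}" using D by (elim conjE)
  have *: "\<forall>U\<in>\<U>. U \<subseteq> S \<times> S \<and> Id_on S \<subseteq> U" using D by (elim conjE)
  show "U \<subseteq> S \<times> S" if "U \<in> \<U>" for U using * that by simp
  show "(x, x) \<in> U" if "U \<in> \<U>" "x \<in> S" for U x using * that by (meson Id_onI subsetD)
  have "\<forall>U\<in>\<U>. \<forall>V. U \<subseteq> V \<and> V \<subseteq> S \<times> S \<longrightarrow> V \<in> \<U>" using D by (elim conjE)
  then show "V \<in> \<U>" if "U \<in> \<U>" "U \<subseteq> V" "V \<subseteq> S \<times> S" for U V using that by meson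
  have "\<forall>U\<in>\<U>. \<forall>V\<in>\<U>. U \<inter> V \<in> \<U>" using D by (elim conjE)
  then show "U \<inter> V \<in> \<U>" if "U \<in> \<U>" "V \<in> \<U>" for U V using that by meson
  have "\<forall>U\<in>\<U>. U\<inverse> \<in> \<U>" using D by (elim conjE)
  then show "U\<inverse> \<in> \<U>" if "U \<in> \<U>" for U using that by meson
  have "\<forall>U\<in>\<U>. \<exists>V\<in>\<U>. V O V \<subseteq> U" using D by (elim conjE)
  then show "\<exists>V\<in>\<U>. V O V \<subseteq> U" if "U \<in> \<U>" for U using that by meson
qed

lemma symmetric_entourage_half:
  assumes "uniformity_on S \<U>" "U \<in> \<U>"
  shows "\<exists>V\<in>\<U>. V\<inverse> = V \<and> V O V \<subseteq> U"
proof -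
  obtain V where V: "V \<in> \<U>" "V O V \<subseteq> U"
    using entourage_half[OF assms] by auto
  have "V \<inter> V\<inverse> \<in> \<U>"
    by (intro entourage_Int[OF assms(1)] entourage_converse[OF assms(1)] V)
  moreover have "(V \<inter> V\<inverse>)\<inverse> = V \<inter> V\<inverse>" by auto
  moreover have "(V \<inter> V\<inverse>) O (V \<inter> V\<inverse>) \<subseteq> U" using V(2) by auto
  ultimately show ?thesis by blast
qed

definition real_entourage :: "'a set \<Rightarrow> ('i \<Rightarrow> 'a \<Rightarrow> real) \<Rightarrow> 'i set \<Rightarrow> real \<Rightarrow> ('a \<times> 'a) set" where
  "real_entourage S F J e = {(x, y) \<in> S \<times> S. \<forall>i\<in>J. \<bar>F i x - F i y\<bar> < e}"

definition uniformly_continuous_real :: "'a set \<Rightarrow> ('a \<times> 'a) set set \<Rightarrow> ('a \<Rightarrow> real) \<Rightarrow> bool" where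
  "uniformly_continuous_real S \<U> f \<longleftrightarrow> (\<forall>e>0. \<exists>V\<in>\<U>. \<forall>(x, y)\<in>V. \<bar>f x - f y\<bar> < e)"

lemma real_entourage_in_uniformity:
  assumes U: "uniformity_on S \<U>" and "finite J" "e > 0"
    and "\<And>i. i \<in> J \<Longrightarrow> uniformly_continuous_real S \<U> (F i)"
  shows "real_entourage S F J e \<in> \<U>"
  using assms(2,4)
proof (induction J rule: finite_induct)
  case empty
  obtain W where "W \<in> \<U>" using uniformity_nonempty[OF U] by blast
  from entourage_mono[OF U this entourage_subset[OF U this]] show ?case
    by (simp add: real_entourage_def)
next
  case (insert i J)
  obtain V where V: "V \<in> \<U>" "\<forall>(x, y)\<in>V. \<bar>F i x - F i y\<bar> < e"
    using insert.prems[of i] \<open>e > 0\<close> unfolding uniformly_continuous_real_def by blast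
  have "real_entourage S F J e \<inter> V \<in> \<U>"
    using insert V by (intro entourage_Int[OF U]) auto
  then show ?case
    by (rule entourage_mono[OF U]) (use V(2) in \<open>auto simp: real_entourage_def\<close>)
qed

text \<open>
  If \<open>f\<close> varies by less than \<open>1\<close> along \<open>V\<close>, then it varies by at most \<open>n\<close> along \<open>V\<^sup>n\<close>, so on \<open>V\<^sup>n(K)\<close>
  it exceeds its maximum on the finite set \<open>K\<close> by at most \<open>n\<close>.
\<close>

lemma bounded_image_of_bourbaki_bounded:
  assumes U: "uniformity_on S \<U>" and B: "bourbaki_bounded S \<U> B"
    and f: "uniformly_continuous_real S \<U> f"
  shows "bounded (f ` B)"
proof -
  obtain V where V: "V \<in> \<U>" "\<forall>(x, y)\<in>V. \<bar>f x - f y\<bar> < 1"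
    using f unfolding uniformly_continuous_real_def by (metis zero_less_one)
  obtain n K where K: "finite K" "B \<subseteq> (V ^^ n) `` K"
    using B V(1) unfolding bourbaki_bounded_def by blast
  have step: "\<bar>f k - f x\<bar> \<le> real m" if "(k, x) \<in> V ^^ m" for k x m
    using that
  proof (induction m arbitrary: x)
    case (Suc m)
    then obtain y where "(k, y) \<in> V ^^ m" "(y, x) \<in> V" by auto
    then show ?case using Suc.IH[of y] V(2) by fastforce
  qed simp
  obtain M where M: "\<And>k. k \<in> K \<Longrightarrow> \<bar>f k\<bar> \<le> M"
    using K(1) finite_imp_bounded[of "f ` K"] unfolding bounded_iff by auto
  have "\<bar>f x\<bar> \<le> M + real n" if "x \<in> B" for x
  proof -
    obtain k where "k \<in> K" "(k, x) \<in> V ^^ n" using K(2) \<open>x \<in> B\<close> by auto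
    then show ?thesis using step[of k x n] M[of k] by linarith
  qed
  then show ?thesis unfolding bounded_iff by auto
qed

section \<open>Separation by uniformly continuous functions\<close>

text \<open>
  For \<open>k < 2\<^sup>n\<close> this is the composition of those \<open>V i\<close> for which the binary expansion of \<open>k / 2\<^sup>n\<close> has
  the digit \<open>1\<close> at the place of weight \<open>2\<close> to the power \<open>-i\<close>; for larger \<open>k\<close> it is the full relation.
  Indexing by the pair \<open>(n, k)\<close> rather than by the fraction lets the recursion strip the last digit.
\<close>

fun dyadic_rel :: "'a set \<Rightarrow> (nat \<Rightarrow> ('a \<times> 'a) set) \<Rightarrow> nat \<Rightarrow> nat \<Rightarrow> ('a \<times> 'a) set" where
  "dyadic_rel S V 0 k = (if k = 0 then Id_on S else S \<times> S)"
| "dyadic_rel S V (Suc n) k =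
     (if even k then dyadic_rel S V n (k div 2) else dyadic_rel S V n (k div 2) O V (Suc n))"

context
  fixes S :: "'a set" and V :: "nat \<Rightarrow> ('a \<times> 'a) set"
  assumes subset: "\<And>n. V n \<subseteq> S \<times> S"
    and refl: "\<And>n x. x \<in> S \<Longrightarrow> (x, x) \<in> V n"
    and comp: "\<And>n. V (Suc n) O V (Suc n) \<subseteq> V n"
begin

lemma dyadic_rel_subset: "dyadic_rel S V n k \<subseteq> S \<times> S"
proof (induction n arbitrary: k)
  case (Suc n)
  have "dyadic_rel S V n (k div 2) O V (Suc n) \<subseteq> S \<times> S"
    using Suc.IH[of "k div 2"] subset[of "Suc n"] by blast
  then show ?case using Suc.IH[of "k div 2"] by simp
qed auto

text \<open>
  Following \<open>V n\<close> costs \<open>1 / 2\<^sup>n\<close>. This is binary addition: if the last digit is \<open>0\<close> it becomes \<open>1\<close>,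
  and if it is \<open>1\<close>, the two factors \<open>V n\<close> are absorbed by \<open>V (n - 1)\<close>, which is the carry.
\<close>

lemma dyadic_rel_comp: "dyadic_rel S V n k O V n \<subseteq> dyadic_rel S V n (Suc k)"
proof (induction n arbitrary: k)
  case 0
  show ?case using subset[of 0] by auto
next
  case (Suc n)
  show ?case
  proof (cases "even k")
    case False
    have "dyadic_rel S V (Suc n) k O V (Suc n)
        = dyadic_rel S V n (k div 2) O (V (Suc n) O V (Suc n))"
      using False by (simp add: O_assoc)
    also have "\<dots> \<subseteq> dyadic_rel S V n (k div 2) O V n"
      using comp by (intro relcomp_mono) auto
    also have "\<dots> \<subseteq> dyadic_rel S V n (Suc (k div 2))" by (rule Suc.IH)
    also have "\<dots> = dyadic_rel S V (Suc n) (Suc k)" using False by simp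
    finally show ?thesis .
  qed simp
qed

lemma dyadic_rel_mono_numerator: "k \<le> l \<Longrightarrow> dyadic_rel S V n k \<subseteq> dyadic_rel S V n l"
proof (induction l rule: dec_induct)
  case (step l)
  have "dyadic_rel S V n l \<subseteq> dyadic_rel S V n l O V n"
    using dyadic_rel_subset[of n l] refl[of _ n] by auto
  then show ?case using step.IH dyadic_rel_comp[of n l] by blast
qed simp

lemma dyadic_rel_expand: "dyadic_rel S V (n + m) (k * 2 ^ m) = dyadic_rel S V n k"
proof (induction m)
  case (Suc m)
  have "k * 2 ^ Suc m div 2 = k * 2 ^ m" by simp
  then show ?case using Suc by simp
qed simp

lemma dyadic_rel_mono:
  assumes "real k / 2 ^ m \<le> real q / 2 ^ n"
  shows "dyadic_rel S V m k \<subseteq> dyadic_rel S V n q"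
proof -
  have "real k * 2 ^ n \<le> real q * 2 ^ m" using assms by (simp add: field_simps)
  then have "real (k * 2 ^ n) \<le> real (q * 2 ^ m)" by simp
  then have "k * 2 ^ n \<le> q * 2 ^ m" by linarith
  then have "dyadic_rel S V (m + n) (k * 2 ^ n) \<subseteq> dyadic_rel S V (n + m) (q * 2 ^ m)"
    by (simp add: add.commute dyadic_rel_mono_numerator)
  then show ?thesis by (simp only: dyadic_rel_expand)
qed

text \<open>
  The cap \<open>1/2\<close> keeps the set nonempty, also for empty \<open>A\<close>, and is the value outside \<open>V 1 `` A\<close>.
\<close>

definition dyadic_height :: "'a set \<Rightarrow> 'a \<Rightarrow> real" where
  "dyadic_height A x =
     Inf (insert (1/2) {real k / 2 ^ n | k n. x \<in> dyadic_rel S V n k `` A})"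

lemma bdd_below_heights:
  "bdd_below (insert (1/2) {real k / 2 ^ n | k n. x \<in> dyadic_rel S V n k `` A})"
  by (rule bdd_belowI[of _ 0]) auto

lemma dyadic_height_bounds: "0 \<le> dyadic_height A x" "dyadic_height A x \<le> 1/2"
  unfolding dyadic_height_def
  by (rule cInf_greatest; auto) (rule cInf_lower[OF insertI1 bdd_below_heights])

lemma dyadic_height_le:
  assumes "x \<in> dyadic_rel S V n k `` A"
  shows "dyadic_height A x \<le> real k / 2 ^ n"
  unfolding dyadic_height_def by (rule cInf_lower[OF _ bdd_below_heights]) (use assms in blast)

lemma dyadic_height_on:
  assumes "x \<in> A" "x \<in> S"
  shows "dyadic_height A x = 0"
proof -
  have "dyadic_height A x \<le> 0"
    using dyadic_height_le[of x 0 0 A] assms by auto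
  then show ?thesis using dyadic_height_bounds(1)[of A x] by linarith
qed

lemma dyadic_height_off:
  assumes "x \<notin> V 1 `` A"
  shows "dyadic_height A x = 1/2"
proof -
  have "1/2 \<le> real k / 2 ^ n" if "x \<in> dyadic_rel S V n k `` A" for k n
  proof (rule ccontr)
    assume "\<not> ?thesis"
    then have "dyadic_rel S V n k \<subseteq> dyadic_rel S V 1 1"
      by (intro dyadic_rel_mono) simp
    also have "\<dots> \<subseteq> V 1" by auto
    finally show False using that assms by blast
  qed
  then have "1/2 \<le> dyadic_height A x"
    unfolding dyadic_height_def by (intro cInf_greatest) blast+
  then show ?thesis using dyadic_height_bounds(2)[of A x] by linarith
qed

text \<open>
  If \<open>x\<close> is reached at cost \<open>r\<close>, rounding \<open>r\<close> up to a multiple of \<open>1 / 2\<^sup>n\<close> costs at most \<open>1 / 2\<^sup>n\<close>, and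
  one further step along \<open>V n\<close> costs the same. The bound does not depend on \<open>A\<close>.
\<close>

lemma dyadic_height_step:
  assumes "(x, y) \<in> V n"
  shows "dyadic_height A y \<le> dyadic_height A x + 2 / 2 ^ n"
proof -
  have "dyadic_height A y - 2 / 2 ^ n \<le> real k / 2 ^ m" if x: "x \<in> dyadic_rel S V m k `` A" for k m
  proof -
    define q where "q = nat \<lceil>2 ^ n * (real k / 2 ^ m)\<rceil>"
    have q: "2 ^ n * (real k / 2 ^ m) \<le> real q" "real q \<le> 2 ^ n * (real k / 2 ^ m) + 1"
      unfolding q_def by (auto simp: real_nat_ceiling_ge of_nat_nat)
    have "dyadic_rel S V m k \<subseteq> dyadic_rel S V n q"
      using q(1) by (intro dyadic_rel_mono) (simp add: field_simps)
    then have "y \<in> dyadic_rel S V n (Suc q) `` A"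
      using x assms dyadic_rel_comp[of n q] by blast
    then have "dyadic_height A y \<le> real (Suc q) / 2 ^ n" by (rule dyadic_height_le)
    also have "\<dots> \<le> (2 ^ n * (real k / 2 ^ m) + 2) / 2 ^ n"
      using q(2) by (intro divide_right_mono) auto
    also have "\<dots> = real k / 2 ^ m + 2 / 2 ^ n" by (simp add: add_divide_distrib)
    finally show ?thesis by linarith
  qed
  moreover have "dyadic_height A y - 2 / 2 ^ n \<le> 1/2"
    using dyadic_height_bounds(2)[of A y] by (smt (verit) divide_nonneg_pos zero_less_power)
  ultimately have "dyadic_height A y - 2 / 2 ^ n \<le> dyadic_height A x"
    unfolding dyadic_height_def[of A x] by (intro cInf_greatest) auto
  then show ?thesis by linarith
qed

end

text \<open>
  The modulus of continuity in the last property serves all sets \<open>A\<close> at once. This is what allows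
  Urysohn functions of infinitely many sets to be added up to a uniformly continuous function.
\<close>

lemma uniform_urysohn:
  fixes \<U> :: "('a \<times> 'a) set set"
  assumes U: "uniformity_on S \<U>" and "U \<in> \<U>"
  obtains h :: "'a set \<Rightarrow> 'a \<Rightarrow> real"
  where "\<And>A x. 0 \<le> h A x" "\<And>A x. h A x \<le> 1"
    and "\<And>A x. x \<in> A \<Longrightarrow> x \<in> S \<Longrightarrow> h A x = 0"
    and "\<And>A x. x \<notin> U `` A \<Longrightarrow> h A x = 1"
    and "\<And>e. e > 0 \<Longrightarrow> \<exists>V\<in>\<U>. \<forall>(x, y)\<in>V. \<forall>A. \<bar>h A x - h A y\<bar> < e"
proof -
  obtain V where V0: "V 0 = U" and V: "\<And>n. V n \<in> \<U>"
    and V': "\<And>n. (V (Suc n))\<inverse> = V (Suc n) \<and> V (Suc n) O V (Suc n) \<subseteq> V n"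
  proof -
    have "\<exists>V. \<forall>n. (V n \<in> \<U> \<and> (n = 0 \<longrightarrow> V n = U)) \<and>
        (V (Suc n))\<inverse> = V (Suc n) \<and> V (Suc n) O V (Suc n) \<subseteq> V n"
    proof (rule dependent_nat_choice[where P = "\<lambda>n V. V \<in> \<U> \<and> (n = 0 \<longrightarrow> V = U)"
          and Q = "\<lambda>n V W. W\<inverse> = W \<and> W O W \<subseteq> V"])
      show "\<exists>V. V \<in> \<U> \<and> (0 = (0::nat) \<longrightarrow> V = U)" using \<open>U \<in> \<U>\<close> by blast
      show "\<exists>W. (W \<in> \<U> \<and> (Suc n = 0 \<longrightarrow> W = U)) \<and> W\<inverse> = W \<and> W O W \<subseteq> V"
        if "V \<in> \<U> \<and> (n = 0 \<longrightarrow> V = U)" for V n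
        using symmetric_entourage_half[OF U, of V] that by blast
    qed
    then obtain V where V: "\<forall>n. (V n \<in> \<U> \<and> (n = 0 \<longrightarrow> V n = U)) \<and>
        (V (Suc n))\<inverse> = V (Suc n) \<and> V (Suc n) O V (Suc n) \<subseteq> V n"
      by (rule exE)
    show thesis
      by (rule that[of V]) (use V[THEN spec] in simp_all)
  qed
  note chain = entourage_subset[OF U V] entourage_refl[OF U V] conjunct2[OF V']
  \<comment> \<open>The heights are at most \<open>1/2\<close>, so the factor \<open>2\<close> normalises them to \<open>[0, 1]\<close>.\<close>
  define h where "h = (\<lambda>A x. 2 * dyadic_height S V A x)"
  show thesis
  proof (rule that[of h])
    show "0 \<le> h A x" "h A x \<le> 1" for A x
      using dyadic_height_bounds[where S = S and V = V, OF chain, of A x] unfolding h_def by auto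
    show "h A x = 0" if "x \<in> A" "x \<in> S" for A x
      using dyadic_height_on[where S = S and V = V, OF chain that] unfolding h_def by auto
    show "h A x = 1" if "x \<notin> U `` A" for A x
    proof -
      have "V 1 \<subseteq> V 1 O V 1"
        using entourage_subset[OF U V, of 1] entourage_refl[OF U V, of _ 1] by auto
      then have "V 1 \<subseteq> U" using V'[of 0] V0 by auto
      then have "x \<notin> V 1 `` A" using that by blast
      then have "dyadic_height S V A x = 1/2"
        using dyadic_height_off[where S = S and V = V, OF chain, of x A] by simp
      then show ?thesis unfolding h_def by simp
    qed
    show "\<exists>W\<in>\<U>. \<forall>(x, y)\<in>W. \<forall>A. \<bar>h A x - h A y\<bar> < e" if "e > 0" for e
    proof -
      obtain n where n: "(1/2) ^ n < e / 4"
        using real_arch_pow_inv[of "e/4" "1/2"] \<open>e > 0\<close> by auto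
      have small: "4 / 2 ^ Suc n < e"
        using n \<open>e > 0\<close> by (simp add: power_divide field_simps)
      have "h A y \<le> h A x + 4 / 2 ^ Suc n" if "(x, y) \<in> V (Suc n)" for A x y
        using dyadic_height_step[where S = S and V = V, OF chain that, of A] unfolding h_def by simp
      moreover have "(y, x) \<in> V (Suc n)" if "(x, y) \<in> V (Suc n)" for x y
        using V'[of n] that by blast
      ultimately have "\<bar>h A x - h A y\<bar> < e" if "(x, y) \<in> V (Suc n)" for A x y
        using that small by (smt (verit))
      then show ?thesis using V[of "Suc n"] by blast
    qed
  qed
qed

section \<open>Detecting unbounded sets by uniformly continuous functions\<close>

text \<open>
  The classes of \<open>U\<^sup>*\<close> are the chain components. If \<open>B\<close> meets infinitely many of them, \<open>g\<close> numbers
  countably many and vanishes on the others. Otherwise \<open>g\<close> counts the \<open>U\<close>-steps needed from a finite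
  set of representatives and vanishes on the components that do not meet \<open>B\<close>. In both cases \<open>g\<close> is
  only ever compared within one component.
\<close>

lemma unbounded_integer_function:
  fixes U :: "('a \<times> 'a) set"
  assumes sym: "U\<inverse> = U" and "B \<subseteq> S"
    and unb: "\<And>n K. finite K \<Longrightarrow> K \<subseteq> S \<Longrightarrow> \<not> B \<subseteq> (U ^^ n) `` K"
    and refl: "\<And>x. x \<in> S \<Longrightarrow> (x, x) \<in> U"
  obtains g :: "'a \<Rightarrow> nat"
  where "\<And>x y. (x, y) \<in> U \<Longrightarrow> g y \<le> Suc (g x)" and "\<And>n. \<exists>x\<in>B. n \<le> g x"
proof -
  define cls where "cls = (\<lambda>x. U\<^sup>* `` {x})"
  have symD: "(y, x) \<in> U" if "(x, y) \<in> U" for x y using sym that by blast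
  have cls_eq: "cls x = cls y" if "(x, y) \<in> U" for x y
    unfolding cls_def using that symD[OF that]
    by (auto intro: converse_rtrancl_into_rtrancl)
  show thesis
  proof (cases "finite (cls ` B)")
    case False
    then obtain f :: "nat \<Rightarrow> 'a set" where f: "inj f" "range f \<subseteq> cls ` B"
      using infinite_countable_subset by blast
    define g where "g = (\<lambda>x. if cls x \<in> range f then inv f (cls x) else 0)"
    show thesis
    proof (rule that[of g])
      show "g y \<le> Suc (g x)" if "(x, y) \<in> U" for x y
        using cls_eq[OF that] by (simp add: g_def)
      show "\<exists>x\<in>B. n \<le> g x" for n
      proof -
        obtain x where "x \<in> B" "f n = cls x" using f(2) by blast
        then have "g x = n" unfolding g_def using f(1) by (metis inv_f_f rangeI)
        then show ?thesis using \<open>x \<in> B\<close> by blast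
      qed
    qed
  next
    case True
    then obtain K where K: "K \<subseteq> B" "finite K" "cls ` B = cls ` K"
      using finite_subset_image[of "cls ` B" cls B] by auto
    have reach: "x \<in> U\<^sup>* `` K" if "x \<in> B" for x
    proof -
      have "cls x \<in> cls ` K" using K(3) that by blast
      then obtain k where "k \<in> K" "cls x = cls k" by auto
      moreover have "x \<in> cls x" unfolding cls_def by simp
      ultimately show ?thesis unfolding cls_def by auto
    qed
    define g where "g = (\<lambda>x. if x \<in> U\<^sup>* `` K then LEAST n. x \<in> (U ^^ n) `` K else 0)"
    have g: "x \<in> (U ^^ g x) `` K" if "x \<in> U\<^sup>* `` K" for x
    proof -
      have "\<exists>n. x \<in> (U ^^ n) `` K" using that rtrancl_power by blast
      from LeastI_ex[OF this] show ?thesis unfolding g_def using that by simp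
    qed
    have mono: "(U ^^ m) `` K \<inter> S \<subseteq> (U ^^ n) `` K" if "m \<le> n" for m n
      using that
    proof (induction n rule: dec_induct)
      case (step n)
      have "(U ^^ n) `` K \<inter> S \<subseteq> (U ^^ Suc n) `` K" using refl by auto
      then show ?case using step.IH by blast
    qed auto
    show thesis
    proof (rule that[of g])
      show "g y \<le> Suc (g x)" if xy: "(x, y) \<in> U" for x y
      proof (cases "y \<in> U\<^sup>* `` K")
        case y: True
        then have x: "x \<in> U\<^sup>* `` K"
          using symD[OF xy] by (auto intro: rtrancl_into_rtrancl)
        have "y \<in> (U ^^ Suc (g x)) `` K" using g[OF x] xy by auto
        then have "(LEAST n. y \<in> (U ^^ n) `` K) \<le> Suc (g x)" by (rule Least_le)
        then show ?thesis using y by (simp add: g_def)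
      qed (simp add: g_def)
      show "\<exists>x\<in>B. n \<le> g x" for n
      proof (rule ccontr)
        assume "\<not> ?thesis"
        then have "g x \<le> n" if "x \<in> B" for x using that by (meson nat_le_linear)
        then have "B \<subseteq> (U ^^ n) `` K"
          using g reach mono \<open>B \<subseteq> S\<close> by (meson IntI subset_eq)
        then show False using unb[of K n] K \<open>B \<subseteq> S\<close> by blast
      qed
    qed
  qed
qed

text \<open>
  With \<open>k n\<close> the Urysohn function that is \<open>0\<close> on \<open>{g \<le> n}\<close> and \<open>1\<close> on \<open>{g \<ge> n + 2}\<close>, the sum of all
  \<open>k n\<close> lies between \<open>g - 1\<close> and \<open>g\<close>. At two points related by \<open>E\<close> the values of \<open>g\<close> differ by at most
  \<open>1\<close>, so that all summands except two agree; the common modulus of the \<open>k n\<close> does the rest.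
\<close>

lemma unbounded_uniformly_continuous_function:
  assumes U: "uniformity_on S \<U>" and "B \<subseteq> S" and nb: "\<not> bourbaki_bounded S \<U> B"
  obtains f where "uniformly_continuous_real S \<U> f" "\<not> bounded (f ` B)"
proof -
  obtain U0 where U0: "U0 \<in> \<U>" "\<not> (\<exists>n K. finite K \<and> K \<subseteq> S \<and> B \<subseteq> (U0 ^^ n) `` K)"
    using nb \<open>B \<subseteq> S\<close> unfolding bourbaki_bounded_def by auto
  define E where "E = U0 \<inter> U0\<inverse>"
  have E: "E \<in> \<U>"
    unfolding E_def by (intro entourage_Int[OF U] entourage_converse[OF U] U0)
  have sym: "E\<inverse> = E" unfolding E_def by auto
  have pow: "E ^^ n \<subseteq> U0 ^^ n" for n
  proof (induction n)
    case (Suc n)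
    then show ?case unfolding relpow.simps by (intro relcomp_mono) (auto simp: E_def)
  qed simp
  obtain g where g: "\<And>x y. (x, y) \<in> E \<Longrightarrow> g y \<le> Suc (g x)" and gB: "\<And>n. \<exists>x\<in>B. n \<le> g x"
  proof (rule unbounded_integer_function[of E B S])
    show "\<not> B \<subseteq> (E ^^ n) `` K" if "finite K" "K \<subseteq> S" for n K
      using U0(2) that pow[of n] by (meson Image_mono order.trans order_refl)
  qed (use sym \<open>B \<subseteq> S\<close> entourage_refl[OF U E] in auto)
  obtain h where h: "\<And>A x. 0 \<le> h A x" "\<And>A x. h A x \<le> (1::real)"
    and h0: "\<And>A x. x \<in> A \<Longrightarrow> x \<in> S \<Longrightarrow> h A x = 0"
    and h1: "\<And>A x. x \<notin> E `` A \<Longrightarrow> h A x = 1"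
    and huc: "\<And>e. e > 0 \<Longrightarrow> \<exists>V\<in>\<U>. \<forall>(x, y)\<in>V. \<forall>A. \<bar>h A x - h A y\<bar> < e"
    by (rule uniform_urysohn[OF U E]) blast
  define k where "k = (\<lambda>n. h {z. g z \<le> n})"
  define f where "f = (\<lambda>x. \<Sum>n<g x. k n x)"
  have k0: "k n x = 0" if "g x \<le> n" "x \<in> S" for n x
    unfolding k_def using that by (intro h0) auto
  have k1: "k n x = 1" if "n + 2 \<le> g x" for n x
    unfolding k_def using that g by (intro h1) fastforce
  have f_eq: "f x = (\<Sum>n<M. k n x)" if "g x \<le> M" "x \<in> S" for x M
    unfolding f_def using that by (intro sum.mono_neutral_left) (auto intro: k0)
  show thesis
  proof (rule that[of f])
    show "uniformly_continuous_real S \<U> f"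
      unfolding uniformly_continuous_real_def
    proof (intro allI impI)
      fix e :: real assume "e > 0"
      then obtain V where V: "V \<in> \<U>" "\<forall>(x, y)\<in>V. \<forall>A. \<bar>h A x - h A y\<bar> < e / 2"
        using huc[of "e/2"] by auto
      have "\<bar>f x - f y\<bar> < e" if xy: "(x, y) \<in> V \<inter> E" for x y
      proof -
        have S: "x \<in> S" "y \<in> S" using xy entourage_subset[OF U E] by auto
        have yx: "(y, x) \<in> E" using xy sym by blast
        have gxy: "g y \<le> Suc (g x)" "g x \<le> Suc (g y)" using g xy yx by auto
        have d: "\<bar>k n x - k n y\<bar> < e/2" for n using V(2) xy unfolding k_def by auto
        \<comment> \<open>Summands below \<open>m - 1\<close> are \<open>1\<close> at both points, those above \<open>m\<close> are \<open>0\<close> at both.\<close>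
        define m where "m = min (g x) (g y)"
        have m: "g x \<le> Suc m" "g y \<le> Suc m" "m \<le> g x" "m \<le> g y"
          using gxy unfolding m_def by auto
        have "f x - f y = (\<Sum>n<Suc m. k n x - k n y)"
          using f_eq[of x "Suc m"] f_eq[of y "Suc m"] m S by (simp add: sum_subtractf)
        also have "\<dots> = (\<Sum>n\<in>{m - 1, m}. k n x - k n y)"
        proof (intro sum.mono_neutral_right ballI)
          fix n assume "n \<in> {..<Suc m} - {m - 1, m}"
          then have "n + 2 \<le> m" by auto
          then show "k n x - k n y = 0" using k1 m by simp
        qed auto
        finally have "\<bar>f x - f y\<bar> \<le> (\<Sum>n\<in>{m - 1, m}. \<bar>k n x - k n y\<bar>)"
          by (simp only: sum_abs)
        also have "\<dots> < e"
          using d[of m] d[of "m - 1"] \<open>e > 0\<close> by (cases "m - 1 = m") auto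
        finally show ?thesis .
      qed
      then show "\<exists>V\<in>\<U>. \<forall>(x, y)\<in>V. \<bar>f x - f y\<bar> < e"
        using entourage_Int[OF U V(1) E] by blast
    qed
    show "\<not> bounded (f ` B)"
    proof
      assume "bounded (f ` B)"
      then obtain M where M: "\<And>x. x \<in> B \<Longrightarrow> \<bar>f x\<bar> \<le> M" unfolding bounded_iff by auto
      obtain x where x: "x \<in> B" "nat \<lceil>M\<rceil> + 2 \<le> g x" using gB by blast
      have "real (g x - 1) = (\<Sum>n<g x - 1. k n x)" using k1 by simp
      also have "\<dots> \<le> f x"
        unfolding f_def k_def using h by (intro sum_mono2) auto
      finally have "real (g x - 1) \<le> M" using M[OF x(1)] by linarith
      then show False using x(2) by linarith
    qed
  qed
qed

section \<open>Spaces described by real coordinates\<close>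

text \<open>
  The middle clause says that the topology is the initial one, with neighbourhoods written as
  entourages so that it can be compared directly with the topology of a uniformity.
\<close>

definition real_coordinates :: "'i set \<Rightarrow> ('i \<Rightarrow> 'a \<Rightarrow> real) \<Rightarrow> 'a born_univ \<Rightarrow> bool" where
  "real_coordinates I F X \<longleftrightarrow>
     (\<forall>x\<in>topspace (fst X). \<forall>y\<in>topspace (fst X). (\<forall>i\<in>I. F i x = F i y) \<longrightarrow> x = y) \<and>
     (\<forall>A. openin (fst X) A \<longleftrightarrow> A \<subseteq> topspace (fst X) \<and>
        (\<forall>x\<in>A. \<exists>J e. finite J \<and> J \<subseteq> I \<and> e > 0 \<and>
            real_entourage (topspace (fst X)) F J e `` {x} \<subseteq> A)) \<and>
     (\<forall>B. B \<in> snd X \<longleftrightarrow> B \<subseteq> topspace (fst X) \<and> (\<forall>i\<in>I. bounded (F i ` B)))"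

lemma real_coordinatesD:
  assumes "real_coordinates I F X"
  shows real_coordinates_separate:
      "\<And>x y. x \<in> topspace (fst X) \<Longrightarrow> y \<in> topspace (fst X) \<Longrightarrow> (\<forall>i\<in>I. F i x = F i y) \<Longrightarrow> x = y"
    and real_coordinates_openin:
      "\<And>A. openin (fst X) A \<longleftrightarrow> A \<subseteq> topspace (fst X) \<and>
        (\<forall>x\<in>A. \<exists>J e. finite J \<and> J \<subseteq> I \<and> e > 0 \<and>
            real_entourage (topspace (fst X)) F J e `` {x} \<subseteq> A)"
    and real_coordinates_bounded:
      "\<And>B. B \<in> snd X \<longleftrightarrow> B \<subseteq> topspace (fst X) \<and> (\<forall>i\<in>I. bounded (F i ` B))"
proof -
  note D = assms[unfolded real_coordinates_def]
  note sep = D[THEN conjunct1, rule_format]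
  note op = D[THEN conjunct2, THEN conjunct1, THEN spec]
  note bd = D[THEN conjunct2, THEN conjunct2, THEN spec]
  show "x = y" if "x \<in> topspace (fst X)" "y \<in> topspace (fst X)" "\<forall>i\<in>I. F i x = F i y" for x y
    by (rule sep) (use that in simp_all)
  show "openin (fst X) A \<longleftrightarrow> A \<subseteq> topspace (fst X) \<and>
        (\<forall>x\<in>A. \<exists>J e. finite J \<and> J \<subseteq> I \<and> e > 0 \<and>
            real_entourage (topspace (fst X)) F J e `` {x} \<subseteq> A)" for A
    by (rule op)
  show "B \<in> snd X \<longleftrightarrow> B \<subseteq> topspace (fst X) \<and> (\<forall>i\<in>I. bounded (F i ` B))" for B
    by (rule bd)
qed

lemma openin_product_euclideanreal:
  "openin (product_topology (\<lambda>_. euclideanreal) I) T \<longleftrightarrow>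
     T \<subseteq> (\<Pi>\<^sub>E i\<in>I. UNIV) \<and>
     (\<forall>x\<in>T. \<exists>J e. finite J \<and> J \<subseteq> I \<and> e > 0 \<and>
        (\<forall>y\<in>\<Pi>\<^sub>E i\<in>I. UNIV. (\<forall>i\<in>J. \<bar>x i - y i\<bar> < e) \<longrightarrow> y \<in> T))"
  (is "_ \<longleftrightarrow> ?sub \<and> (\<forall>x\<in>T. ?nbhd x)")
proof (intro iffI conjI ballI)
  assume T: "openin (product_topology (\<lambda>_. euclideanreal) I) T"
  show "?sub" using openin_subset[OF T] by simp
  fix x assume "x \<in> T"
  then obtain U where U: "finite {i\<in>I. U i \<noteq> UNIV}" "\<forall>i\<in>I. open (U i)" "x \<in> Pi\<^sub>E I U" "Pi\<^sub>E I U \<subseteq> T"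
    using T unfolding openin_product_topology_alt by auto
  define J where "J = {i\<in>I. U i \<noteq> UNIV}"
  have "\<exists>d>0. \<forall>t. \<bar>x i - t\<bar> < d \<longrightarrow> t \<in> U i" if "i \<in> J" for i
  proof -
    have "open (U i)" "x i \<in> U i" using U(2,3) that unfolding J_def by auto
    then obtain d where "d > 0" "\<forall>t. dist t (x i) < d \<longrightarrow> t \<in> U i"
      unfolding open_dist by blast
    then show ?thesis by (auto simp: dist_real_def abs_minus_commute)
  qed
  then obtain d where d: "\<And>i. i \<in> J \<Longrightarrow> d i > 0"
    "\<And>i t. i \<in> J \<Longrightarrow> \<bar>x i - t\<bar> < d i \<Longrightarrow> t \<in> U i" by metis
  have J: "finite J" "J \<subseteq> I" using U(1) unfolding J_def by auto
  define e where "e = Min (insert 1 (d ` J))"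
  have "e > 0" "\<And>i. i \<in> J \<Longrightarrow> e \<le> d i" using J d(1) unfolding e_def by auto
  moreover have "y \<in> T" if "y \<in> (\<Pi>\<^sub>E i\<in>I. UNIV)" "\<forall>i\<in>J. \<bar>x i - y i\<bar> < e" for y
  proof -
    have "y i \<in> U i" if "i \<in> I" for i
    proof (cases "i \<in> J")
      case True
      then show ?thesis
        using d(2) \<open>\<forall>i\<in>J. \<bar>x i - y i\<bar> < e\<close> \<open>\<And>i. i \<in> J \<Longrightarrow> e \<le> d i\<close> by (meson less_le_trans)
    qed (use that in \<open>auto simp: J_def\<close>)
    then have "y \<in> Pi\<^sub>E I U" using that(1) by (auto simp: PiE_iff)
    then show ?thesis using U(4) by blast
  qed
  ultimately show "?nbhd x" using J by blast
next
  assume T: "?sub \<and> (\<forall>x\<in>T. ?nbhd x)"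
  show "openin (product_topology (\<lambda>_. euclideanreal) I) T"
    unfolding openin_product_topology_alt
  proof
    fix x assume "x \<in> T"
    then obtain J e where J: "finite J" "J \<subseteq> I" "e > 0"
      and e: "\<And>y. y \<in> (\<Pi>\<^sub>E i\<in>I. UNIV) \<Longrightarrow> (\<forall>i\<in>J. \<bar>x i - y i\<bar> < e) \<Longrightarrow> y \<in> T"
      using T by meson
    define U where "U = (\<lambda>i. if i \<in> J then {t. \<bar>x i - t\<bar> < e} else UNIV)"
    have "{i\<in>I. U i \<noteq> topspace euclideanreal} \<subseteq> J" unfolding U_def by auto
    then have "finite {i\<in>I. U i \<noteq> topspace euclideanreal}" using J(1) finite_subset by blast
    moreover have "openin euclideanreal (U i)" for i
      unfolding U_def by (auto intro!: open_Collect_less continuous_intros)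
    moreover have "x \<in> Pi\<^sub>E I U" using T \<open>x \<in> T\<close> \<open>e > 0\<close> by (auto simp: U_def PiE_iff)
    moreover have "Pi\<^sub>E I U \<subseteq> T"
    proof
      fix y assume "y \<in> Pi\<^sub>E I U"
      then show "y \<in> T"
        using J(2) by (intro e) (auto simp: U_def PiE_iff split: if_splits)
    qed
    ultimately show "\<exists>U. finite {i \<in> I. U i \<noteq> topspace euclideanreal} \<and>
        (\<forall>i\<in>I. openin euclideanreal (U i)) \<and> x \<in> Pi\<^sub>E I U \<and> Pi\<^sub>E I U \<subseteq> T"
      by blast
  qed
qed

lemma born_product_real_lines:
  "fst (born_product I (\<lambda>_. born_real_line)) = product_topology (\<lambda>_. euclideanreal) I"
  "B \<in> snd (born_product I (\<lambda>_. born_real_line)) \<longleftrightarrow>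
     B \<subseteq> (\<Pi>\<^sub>E i\<in>I. UNIV) \<and> (\<forall>i\<in>I. bounded ((\<lambda>x. x i) ` B))"
  by (auto simp: born_product_def born_real_line_def)

text \<open>
  A union of boxes centred at points of \<open>T\<close> is an open set of the product with trace \<open>T\<close> on \<open>Y\<close>.
\<close>

lemma openin_subspace_of_real_lines:
  assumes Y: "Y \<subseteq> (\<Pi>\<^sub>E i\<in>I. UNIV)"
  shows "openin (subtopology (product_topology (\<lambda>_. euclideanreal) I) Y) T \<longleftrightarrow>
     T \<subseteq> Y \<and> (\<forall>x\<in>T. \<exists>J e. finite J \<and> J \<subseteq> I \<and> e > 0 \<and>
        (\<forall>y\<in>Y. (\<forall>i\<in>J. \<bar>x i - y i\<bar> < e) \<longrightarrow> y \<in> T))"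
  (is "_ \<longleftrightarrow> _ \<and> (\<forall>x\<in>T. ?nbhd x)")
proof
  assume "openin (subtopology (product_topology (\<lambda>_. euclideanreal) I) Y) T"
  then obtain G where G: "openin (product_topology (\<lambda>_. euclideanreal) I) G" "T = G \<inter> Y"
    unfolding openin_subtopology by blast
  have "?nbhd x" if "x \<in> T" for x
  proof -
    obtain J e where "finite J" "J \<subseteq> I" "e > 0"
      "\<forall>y\<in>\<Pi>\<^sub>E i\<in>I. UNIV. (\<forall>i\<in>J. \<bar>x i - y i\<bar> < e) \<longrightarrow> y \<in> G"
      using G \<open>x \<in> T\<close> unfolding openin_product_euclideanreal by blast
    then show ?thesis using Y unfolding G(2) by (intro exI[of _ J] exI[of _ e]) auto
  qed
  then show "T \<subseteq> Y \<and> (\<forall>x\<in>T. ?nbhd x)" using G(2) by blast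
next
  assume T: "T \<subseteq> Y \<and> (\<forall>x\<in>T. ?nbhd x)"
  define N where "N = (\<lambda>x J e. {y \<in> \<Pi>\<^sub>E i\<in>I. UNIV. \<forall>i\<in>J. \<bar>x i - y i\<bar> < (e::real)})"
  have N: "openin (product_topology (\<lambda>_. euclideanreal) I) (N x J e)"
    if "finite J" "J \<subseteq> I" for x J e
    unfolding openin_product_euclideanreal
  proof (intro conjI ballI)
    fix z assume z: "z \<in> N x J e"
    define d where "d = Min (insert 1 ((\<lambda>i. e - \<bar>x i - z i\<bar>) ` J))"
    have "d > 0" "\<And>i. i \<in> J \<Longrightarrow> d \<le> e - \<bar>x i - z i\<bar>"
      using that z unfolding d_def by (auto simp: N_def)
    moreover have "y \<in> N x J e" if "y \<in> (\<Pi>\<^sub>E i\<in>I. UNIV)" "\<forall>i\<in>J. \<bar>z i - y i\<bar> < d" for y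
      using that \<open>\<And>i. i \<in> J \<Longrightarrow> d \<le> e - \<bar>x i - z i\<bar>\<close> unfolding N_def by fastforce
    ultimately show "\<exists>J' d. finite J' \<and> J' \<subseteq> I \<and> d > 0 \<and>
        (\<forall>y\<in>\<Pi>\<^sub>E i\<in>I. UNIV. (\<forall>i\<in>J'. \<bar>z i - y i\<bar> < d) \<longrightarrow> y \<in> N x J e)"
      using that by blast
  qed (auto simp: N_def)
  define G where "G = \<Union>{N x J e | x J e. finite J \<and> J \<subseteq> I \<and> N x J e \<inter> Y \<subseteq> T}"
  have "openin (product_topology (\<lambda>_. euclideanreal) I) G"
    unfolding G_def using N by (intro openin_Union) blast
  moreover have "T = G \<inter> Y"
  proof
    show "G \<inter> Y \<subseteq> T" unfolding G_def by blast
    show "T \<subseteq> G \<inter> Y"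
    proof
      fix x assume "x \<in> T"
      then obtain J e where J: "finite J" "J \<subseteq> I" "e > 0"
        "\<forall>y\<in>Y. (\<forall>i\<in>J. \<bar>x i - y i\<bar> < e) \<longrightarrow> y \<in> T"
        using T by meson
      have "x \<in> N x J e" using \<open>x \<in> T\<close> T Y \<open>e > 0\<close> unfolding N_def by auto
      moreover have "N x J e \<inter> Y \<subseteq> T" using J(4) unfolding N_def by blast
      ultimately show "x \<in> G \<inter> Y" using J T \<open>x \<in> T\<close> unfolding G_def by blast
    qed
  qed
  ultimately show "openin (subtopology (product_topology (\<lambda>_. euclideanreal) I) Y) T"
    unfolding openin_subtopology by blast
qed

text \<open>
  The coordinates of an isomorphism \<open>\<phi>\<close> are \<open>x \<mapsto> \<phi> x i\<close>; conversely, a family \<open>F\<close> yields the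
  evaluation map \<open>x \<mapsto> (F i x)\<^sub>i\<close>. An injective map onto \<open>Y\<close> translates the neighbourhoods and the
  bounded sets of \<open>Y\<close> into the clauses of the coordinate description.
\<close>

lemma iso_to_subspace_iff_real_coordinates:
  fixes X :: "'a born_univ"
  assumes X: "bornological_universe X"
  shows "iso_to_subspace_of_real_lines TYPE('i) X \<longleftrightarrow>
    (\<exists>(I :: 'i set) F. real_coordinates I F X)"
proof
  define S where "S = topspace (fst X)"
  have bornS: "B \<subseteq> S" if "B \<in> snd X" for B
    using X that unfolding bornological_universe_def bornology_on_def S_def by blast
  {
    assume "iso_to_subspace_of_real_lines TYPE('i) X"
    then obtain I :: "'i set" and Y \<phi> where Y: "Y \<subseteq> (\<Pi>\<^sub>E i\<in>I. UNIV)"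
      and \<phi>: "born_isomorphism X (born_subspace (born_product I (\<lambda>_. born_real_line)) Y) \<phi>"
      unfolding iso_to_subspace_of_real_lines_def born_isomorphic_def
      by (auto simp: born_product_real_lines)
    define P where "P = subtopology (product_topology (\<lambda>_. euclideanreal) I) Y"
    define \<psi> where "\<psi> = inv_into S \<phi>"
    have fstP: "fst (born_subspace (born_product I (\<lambda>_. born_real_line)) Y) = P"
      unfolding P_def born_subspace_def by (simp add: born_product_real_lines)
    have topP: "topspace P = Y" using Y unfolding P_def by auto
    have bij: "bij_betw \<phi> S Y" and cont: "continuous_map (fst X) P \<phi>" "continuous_map P (fst X) \<psi>"
      and bd: "\<And>B. B \<in> snd X \<Longrightarrow> \<phi> ` B \<in> snd (born_product I (\<lambda>_. born_real_line))"
      and bd': "\<And>B. B \<in> snd (born_product I (\<lambda>_. born_real_line)) \<Longrightarrow> B \<subseteq> Y \<Longrightarrow> \<psi> ` B \<in> snd X"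
      using \<phi> unfolding born_isomorphism_def born_morphism_def fstP topP S_def[symmetric] \<psi>_def[symmetric]
      by (auto simp: born_subspace_def)
    have inj: "inj_on \<phi> S" and im: "\<phi> ` S = Y" using bij unfolding bij_betw_def by auto
    have \<psi>\<phi>: "\<psi> (\<phi> x) = x" if "x \<in> S" for x using inj that unfolding \<psi>_def by simp
    have "homeomorphic_maps (fst X) P \<phi> \<psi>"
      unfolding homeomorphic_maps_def topP S_def[symmetric]
      using cont \<psi>\<phi> im by auto
    then have hom: "homeomorphic_map (fst X) P \<phi>" using homeomorphic_map_maps by blast
    define F where "F = (\<lambda>i x. \<phi> x i)"
    have "real_coordinates I F X"
      unfolding real_coordinates_def S_def[symmetric]
    proof (intro conjI allI ballI impI)
      fix x y assume xy: "x \<in> S" "y \<in> S" "\<forall>i\<in>I. F i x = F i y"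
      have "\<phi> x \<in> (\<Pi>\<^sub>E i\<in>I. UNIV)" "\<phi> y \<in> (\<Pi>\<^sub>E i\<in>I. UNIV)" using xy im Y by auto
      then have "\<phi> x = \<phi> y" using xy(3) unfolding F_def by (auto intro: PiE_ext)
      then show "x = y" using xy inj by (simp add: inj_on_eq_iff)
    next
      fix A
      have "openin (fst X) A \<longleftrightarrow> A \<subseteq> S \<and> openin P (\<phi> ` A)"
        using homeomorphic_map_openness_eq[OF hom] unfolding S_def .
      also have "\<dots> \<longleftrightarrow> A \<subseteq> S \<and> (\<forall>x\<in>A. \<exists>J e. finite J \<and> J \<subseteq> I \<and> e > 0 \<and>
          real_entourage S F J e `` {x} \<subseteq> A)"
      proof (rule conj_cong[OF refl])
        assume A: "A \<subseteq> S"
        have "(\<forall>y\<in>Y. (\<forall>i\<in>J. \<bar>\<phi> x i - y i\<bar> < e) \<longrightarrow> y \<in> \<phi> ` A) \<longleftrightarrow>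
            real_entourage S F J e `` {x} \<subseteq> A" if "x \<in> A" for x J and e :: real
        proof -
          have "\<phi> y \<in> \<phi> ` A \<longleftrightarrow> y \<in> A" if "y \<in> S" for y
            using inj that A by (rule inj_on_image_mem_iff)
          then show ?thesis
            using A that unfolding im[symmetric] real_entourage_def F_def by auto
        qed
        then show "openin P (\<phi> ` A) \<longleftrightarrow> (\<forall>x\<in>A. \<exists>J e. finite J \<and> J \<subseteq> I \<and> e > 0 \<and>
            real_entourage S F J e `` {x} \<subseteq> A)"
          unfolding P_def openin_subspace_of_real_lines[OF Y] using A im by auto
      qed
      finally show "openin (fst X) A \<longleftrightarrow> A \<subseteq> S \<and> (\<forall>x\<in>A. \<exists>J e. finite J \<and> J \<subseteq> I \<and> e > 0 \<and>
          real_entourage S F J e `` {x} \<subseteq> A)" .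
    next
      fix B
      show "B \<in> snd X \<longleftrightarrow> B \<subseteq> S \<and> (\<forall>i\<in>I. bounded (F i ` B))"
      proof
        assume B: "B \<in> snd X"
        show "B \<subseteq> S \<and> (\<forall>i\<in>I. bounded (F i ` B))"
          using bornS[OF B] bd[OF B] unfolding born_product_real_lines F_def
          by (simp add: image_image)
      next
        assume B: "B \<subseteq> S \<and> (\<forall>i\<in>I. bounded (F i ` B))"
        have "\<phi> ` B \<subseteq> Y" using B im by blast
        moreover from this have "\<phi> ` B \<in> snd (born_product I (\<lambda>_. born_real_line))"
          using B Y unfolding born_product_real_lines F_def by (auto simp: image_image)
        ultimately have "\<psi> ` \<phi> ` B \<in> snd X" using bd' by blast
        moreover have "\<psi> ` \<phi> ` B = B" using B \<psi>\<phi> by force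
        ultimately show "B \<in> snd X" by simp
      qed
    qed
    then show "\<exists>(I :: 'i set) F. real_coordinates I F X" by blast
  next
    assume "\<exists>(I :: 'i set) F. real_coordinates I F X"
    then obtain I :: "'i set" and F where F: "real_coordinates I F X" by blast
    note sepF = real_coordinates_separate[OF F, folded S_def]
    and opF = real_coordinates_openin[OF F, folded S_def]
    and bdF = real_coordinates_bounded[OF F, folded S_def]
    define \<phi> where "\<phi> = (\<lambda>x. \<lambda>i\<in>I. F i x)"
    define Y where "Y = \<phi> ` S"
    have Y: "Y \<subseteq> (\<Pi>\<^sub>E i\<in>I. UNIV)" unfolding Y_def \<phi>_def by auto
    define P where "P = subtopology (product_topology (\<lambda>_. euclideanreal) I) Y"
    have fstP: "fst (born_subspace (born_product I (\<lambda>_. born_real_line)) Y) = P"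
      unfolding P_def born_subspace_def by (simp add: born_product_real_lines)
    have topP: "topspace P = Y" using Y unfolding P_def by auto
    have inj: "inj_on \<phi> S"
    proof (rule inj_onI)
      fix x y assume "x \<in> S" "y \<in> S" "\<phi> x = \<phi> y"
      moreover from \<open>\<phi> x = \<phi> y\<close> have "\<forall>i\<in>I. F i x = F i y"
        unfolding \<phi>_def by (metis restrict_apply')
      ultimately show "x = y" by (intro sepF)
    qed
    have op: "openin P (\<phi> ` A) \<longleftrightarrow> openin (fst X) A" if A: "A \<subseteq> S" for A
    proof -
      have "(\<forall>y\<in>Y. (\<forall>i\<in>J. \<bar>\<phi> x i - y i\<bar> < e) \<longrightarrow> y \<in> \<phi> ` A) \<longleftrightarrow>
          real_entourage S F J e `` {x} \<subseteq> A" if "x \<in> A" "J \<subseteq> I" for x J and e :: real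
      proof -
        have *: "\<phi> y \<in> \<phi> ` A \<longleftrightarrow> y \<in> A" if "y \<in> S" for y
          using inj that A by (rule inj_on_image_mem_iff)
        have "\<phi> y i = F i y" if "i \<in> J" for y i using that \<open>J \<subseteq> I\<close> unfolding \<phi>_def by auto
        then show ?thesis
          using A that * unfolding Y_def real_entourage_def by auto
      qed
      then have "openin P (\<phi> ` A) \<longleftrightarrow> (\<forall>x\<in>A. \<exists>J e. finite J \<and> J \<subseteq> I \<and> e > 0 \<and>
          real_entourage S F J e `` {x} \<subseteq> A)"
        unfolding P_def openin_subspace_of_real_lines[OF Y] using A
        by (auto simp: Y_def cong: conj_cong)
      then show ?thesis using A unfolding opF by simp
    qed
    have bij: "bij_betw \<phi> S Y" using inj unfolding Y_def bij_betw_def by simp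
    define \<psi> where "\<psi> = inv_into S \<phi>"
    have \<psi>\<phi>: "\<psi> (\<phi> x) = x" if "x \<in> S" for x using inj that unfolding \<psi>_def by simp
    have pre: "\<phi> ` {x \<in> S. \<phi> x \<in> T} = T" if "T \<subseteq> Y" for T using that unfolding Y_def by auto
    have pre': "{y \<in> Y. \<psi> y \<in> A} = \<phi> ` A" if "A \<subseteq> S" for A
      using that \<psi>\<phi> unfolding Y_def by force
    have c: "continuous_map (fst X) P \<phi>"
      unfolding continuous_map_def topP S_def[symmetric]
    proof (intro conjI allI impI)
      fix T assume T: "openin P T"
      then have "T \<subseteq> Y" using openin_subset topP by blast
      then show "openin (fst X) {x \<in> S. \<phi> x \<in> T}"
        using op[of "{x \<in> S. \<phi> x \<in> T}"] pre T by auto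
    qed (auto simp: Y_def)
    have c': "continuous_map P (fst X) \<psi>"
      unfolding continuous_map_def topP S_def[symmetric]
    proof (intro conjI allI impI)
      fix A assume A: "openin (fst X) A"
      then have "A \<subseteq> S" unfolding S_def by (rule openin_subset)
      then show "openin P {y \<in> Y. \<psi> y \<in> A}" using op pre' A by simp
    qed (auto simp: Y_def \<psi>\<phi>)
    have coord: "(\<lambda>x. x i) ` \<phi> ` B = F i ` B" if "i \<in> I" for i B
      using that unfolding \<phi>_def by (simp add: image_image)
    have "born_isomorphism X (born_subspace (born_product I (\<lambda>_. born_real_line)) Y) \<phi>"
      unfolding born_isomorphism_def born_morphism_def fstP topP S_def[symmetric] \<psi>_def[symmetric]
    proof (intro conjI ballI bij c c')
      fix B assume B: "B \<in> snd X"
      then have "\<phi> ` B \<subseteq> Y" using bornS unfolding Y_def by blast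
      moreover have "\<forall>i\<in>I. bounded (F i ` B)" using B unfolding bdF by simp
      ultimately show "\<phi> ` B \<in> snd (born_subspace (born_product I (\<lambda>_. born_real_line)) Y)"
        using Y coord by (auto simp: born_subspace_def born_product_real_lines)
    next
      fix D assume "D \<in> snd (born_subspace (born_product I (\<lambda>_. born_real_line)) Y)"
      then have D: "D \<subseteq> Y" "\<forall>i\<in>I. bounded ((\<lambda>x. x i) ` D)"
        by (auto simp: born_subspace_def born_product_real_lines)
      obtain B where B: "B \<subseteq> S" "D = \<phi> ` B" using D(1) unfolding Y_def by (rule subset_imageE)
      have "\<forall>i\<in>I. bounded (F i ` B)" using D(2) coord unfolding B(2) by simp
      then have "B \<in> snd X" using B(1) unfolding bdF by simp
      moreover have "\<psi> ` D = B" using B \<psi>\<phi> by force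
      ultimately show "\<psi> ` D \<in> snd X" by simp
    qed
    then show "iso_to_subspace_of_real_lines TYPE('i) X"
      unfolding iso_to_subspace_of_real_lines_def born_isomorphic_def
      using Y by (intro exI[of _ I] exI[of _ Y]) (auto simp: born_product_real_lines)
  }
qed

section \<open>The uniformity of a family of real functions\<close>

definition initial_uniformity :: "'a set \<Rightarrow> 'i set \<Rightarrow> ('i \<Rightarrow> 'a \<Rightarrow> real) \<Rightarrow> ('a \<times> 'a) set set" where
  "initial_uniformity S I F =
     {U. U \<subseteq> S \<times> S \<and> (\<exists>J e. finite J \<and> J \<subseteq> I \<and> e > 0 \<and> real_entourage S F J e \<subseteq> U)}"

lemma real_entourage_in_initial_uniformity:
  "finite J \<Longrightarrow> J \<subseteq> I \<Longrightarrow> e > 0 \<Longrightarrow> real_entourage S F J e \<in> initial_uniformity S I F"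
  unfolding initial_uniformity_def by (auto simp: real_entourage_def)

lemma uniformity_on_initial: "uniformity_on S (initial_uniformity S I F)"
  unfolding uniformity_on_def
proof (intro conjI ballI allI impI)
  show "initial_uniformity S I F \<noteq> {}"
    using real_entourage_in_initial_uniformity[of "{}" I 1 S F] by auto
  fix U assume "U \<in> initial_uniformity S I F"
  then obtain J e where U: "U \<subseteq> S \<times> S" and J: "finite J" "J \<subseteq> I" "e > 0" "real_entourage S F J e \<subseteq> U"
    unfolding initial_uniformity_def by auto
  show "U \<subseteq> S \<times> S" by fact
  have "Id_on S \<subseteq> real_entourage S F J e" using \<open>e > 0\<close> by (auto simp: real_entourage_def)
  then show "Id_on S \<subseteq> U" using J(4) by blast
  show "V \<in> initial_uniformity S I F" if "U \<subseteq> V \<and> V \<subseteq> S \<times> S" for V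
    using that J unfolding initial_uniformity_def by blast
  have "real_entourage S F J e \<subseteq> U\<inverse>"
    using J(4) by (auto simp: real_entourage_def abs_minus_commute)
  moreover have "U\<inverse> \<subseteq> S \<times> S" using U by auto
  ultimately show "U\<inverse> \<in> initial_uniformity S I F" using J unfolding initial_uniformity_def by blast
  have "real_entourage S F J (e/2) O real_entourage S F J (e/2) \<subseteq> real_entourage S F J e"
  proof clarify
    fix x y z
    assume xy: "(x, y) \<in> real_entourage S F J (e/2)" and yz: "(y, z) \<in> real_entourage S F J (e/2)"
    have "\<bar>F i x - F i z\<bar> < e" if "i \<in> J" for i
    proof -
      have "\<bar>F i x - F i y\<bar> < e/2" "\<bar>F i y - F i z\<bar> < e/2"
        using xy yz that unfolding real_entourage_def by auto
      then show ?thesis by linarith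
    qed
    then show "(x, z) \<in> real_entourage S F J e"
      using xy yz unfolding real_entourage_def by auto
  qed
  then have "real_entourage S F J (e/2) O real_entourage S F J (e/2) \<subseteq> U" using J(4) by blast
  moreover have "real_entourage S F J (e/2) \<in> initial_uniformity S I F"
    using J by (intro real_entourage_in_initial_uniformity) auto
  ultimately show "\<exists>V\<in>initial_uniformity S I F. V O V \<subseteq> U" by blast
  fix V assume "V \<in> initial_uniformity S I F"
  then obtain J' e' where J': "finite J'" "J' \<subseteq> I" "e' > 0" "real_entourage S F J' e' \<subseteq> V"
    unfolding initial_uniformity_def by auto
  have "real_entourage S F (J \<union> J') (min e e') \<subseteq> U \<inter> V"
    using J(4) J'(4) unfolding real_entourage_def by auto
  then show "U \<inter> V \<in> initial_uniformity S I F"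
    using J J' U unfolding initial_uniformity_def
    by (auto intro!: exI[of _ "J \<union> J'"] exI[of _ "min e e'"])
qed

lemma uniformly_continuous_initial:
  assumes "i \<in> I"
  shows "uniformly_continuous_real S (initial_uniformity S I F) (F i)"
  unfolding uniformly_continuous_real_def
proof (intro allI impI)
  fix e :: real assume "e > 0"
  then have "real_entourage S F {i} e \<in> initial_uniformity S I F"
    using assms by (intro real_entourage_in_initial_uniformity) auto
  then show "\<exists>V\<in>initial_uniformity S I F. \<forall>(x, y)\<in>V. \<bar>F i x - F i y\<bar> < e"
    by (rule rev_bexI) (auto simp: real_entourage_def)
qed

text \<open>
  The pigeonhole principle: \<open>c\<close> sends a point to the grid cell of side \<open>e\<close> that contains its
  coordinates in \<open>J\<close>. Boundedness leaves finitely many cells that meet \<open>B\<close>, and \<open>K\<close> picks a point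
  of \<open>B\<close> in each of them.
\<close>

lemma totally_bounded_real_entourage:
  assumes "finite J" "e > 0" "B \<subseteq> S" and bd: "\<And>i. i \<in> J \<Longrightarrow> bounded (F i ` B)"
  obtains K where "finite K" "K \<subseteq> B" "B \<subseteq> real_entourage S F J e `` K"
proof -
  define c where "c = (\<lambda>x. \<lambda>i\<in>J. \<lfloor>F i x / e\<rfloor>)"
  have "\<exists>M. \<forall>x\<in>B. \<bar>F i x\<bar> \<le> M" if "i \<in> J" for i
    using bd[OF that] unfolding bounded_iff by auto
  then obtain M where M: "\<And>i x. i \<in> J \<Longrightarrow> x \<in> B \<Longrightarrow> \<bar>F i x\<bar> \<le> M i" by metis
  have "c ` B \<subseteq> (\<Pi>\<^sub>E i\<in>J. {\<lfloor>- M i / e\<rfloor>..\<lfloor>M i / e\<rfloor>})"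
  proof (intro image_subsetI PiE_I)
    fix x i assume x: "x \<in> B" and i: "i \<in> J"
    have "- M i / e \<le> F i x / e" "F i x / e \<le> M i / e"
      using M[OF i x] \<open>e > 0\<close> by (intro divide_right_mono; linarith)+
    then show "c x i \<in> {\<lfloor>- M i / e\<rfloor>..\<lfloor>M i / e\<rfloor>}"
      using i unfolding c_def by (auto intro: floor_mono)
  qed (simp add: c_def)
  then have "finite (c ` B)" by (rule finite_subset) (use assms(1) in \<open>auto intro: finite_PiE\<close>)
  then obtain K where K: "K \<subseteq> B" "finite K" "c ` B = c ` K"
    using finite_subset_image[of "c ` B" c B] by auto
  have "x \<in> real_entourage S F J e `` K" if x: "x \<in> B" for x
  proof -
    have "c x \<in> c ` K" using K(3) x by blast
    then obtain k where k: "k \<in> K" "c x = c k" by auto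
    have "\<bar>F i k - F i x\<bar> < e" if "i \<in> J" for i
    proof -
      have "\<lfloor>F i x / e\<rfloor> = \<lfloor>F i k / e\<rfloor>" using k(2) that unfolding c_def by (metis restrict_apply')
      then have "\<bar>F i k / e - F i x / e\<bar> < 1" by linarith
      then have "\<bar>(F i k - F i x) / e\<bar> < 1" by (simp add: diff_divide_distrib)
      then show ?thesis using \<open>e > 0\<close> by (simp add: abs_divide)
    qed
    then show ?thesis using k(1) K(1) x assms(3) unfolding real_entourage_def by auto
  qed
  then show thesis using that[of K] K by blast
qed

lemma bourbaki_bounded_initial:
  "bourbaki_bounded S (initial_uniformity S I F) B \<longleftrightarrow> B \<subseteq> S \<and> (\<forall>i\<in>I. bounded (F i ` B))"
proof
  assume B: "bourbaki_bounded S (initial_uniformity S I F) B"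
  then show "B \<subseteq> S \<and> (\<forall>i\<in>I. bounded (F i ` B))"
    using bounded_image_of_bourbaki_bounded[OF uniformity_on_initial B uniformly_continuous_initial]
    unfolding bourbaki_bounded_def by blast
next
  assume B: "B \<subseteq> S \<and> (\<forall>i\<in>I. bounded (F i ` B))"
  show "bourbaki_bounded S (initial_uniformity S I F) B"
    unfolding bourbaki_bounded_def
  proof (intro conjI ballI)
    fix U assume "U \<in> initial_uniformity S I F"
    then obtain J e where J: "finite J" "J \<subseteq> I" "e > 0" "real_entourage S F J e \<subseteq> U"
      unfolding initial_uniformity_def by auto
    obtain K where K: "finite K" "K \<subseteq> B" "B \<subseteq> real_entourage S F J e `` K"
    proof (rule totally_bounded_real_entourage)
      show "finite J" "e > 0" "B \<subseteq> S" using J B by auto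
      show "bounded (F i ` B)" if "i \<in> J" for i using that B J(2) by blast
    qed
    have "B \<subseteq> U `` K" using K(3) J(4) by blast
    then have "B \<subseteq> (U ^^ 1) `` K" by simp
    then show "\<exists>n K. finite K \<and> K \<subseteq> S \<and> B \<subseteq> (U ^^ n) `` K" using K B by blast
  qed (use B in blast)
qed

section \<open>Hausdorff uniformizable universes and real coordinates\<close>

lemma Hausdorff_uniformizable_if_real_coordinates:
  assumes F: "real_coordinates I F X"
  shows "Hausdorff_space (fst X) \<and> uniformizable X"
proof
  define S where "S = topspace (fst X)"
  note sepF = real_coordinates_separate[OF F, folded S_def]
    and opF = real_coordinates_openin[OF F, folded S_def]
    and bdF = real_coordinates_bounded[OF F, folded S_def]
  define \<U> where "\<U> = initial_uniformity S I F"
  have U: "uniformity_on S \<U>" unfolding \<U>_def by (rule uniformity_on_initial)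
  have "openin (uniform_topology S \<U>) A \<longleftrightarrow> openin (fst X) A" for A
  proof -
    have "(\<exists>U\<in>\<U>. U `` {x} \<subseteq> A) \<longleftrightarrow>
        (\<exists>J e. finite J \<and> J \<subseteq> I \<and> e > 0 \<and> real_entourage S F J e `` {x} \<subseteq> A)" for x
    proof
      assume "\<exists>U\<in>\<U>. U `` {x} \<subseteq> A"
      then show "\<exists>J e. finite J \<and> J \<subseteq> I \<and> e > 0 \<and> real_entourage S F J e `` {x} \<subseteq> A"
        unfolding \<U>_def initial_uniformity_def by blast
    qed (use real_entourage_in_initial_uniformity in \<open>unfold \<U>_def, blast\<close>)
    then show ?thesis unfolding openin_uniform_topology[OF U] opF by simp
  qed
  then have "uniform_topology S \<U> = fst X" by (simp add: topology_eq)
  moreover have "snd X = {B. bourbaki_bounded S \<U> B}"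
    unfolding \<U>_def bourbaki_bounded_initial using bdF by blast
  ultimately show "uniformizable X"
    unfolding uniformizable_def S_def[symmetric] using U by blast
  have op: "openin (fst X) {z \<in> S. \<bar>F i x - F i z\<bar> < e}" if "i \<in> I" for i x e
  proof -
    have "\<exists>J d. finite J \<and> J \<subseteq> I \<and> d > 0 \<and>
        real_entourage S F J d `` {z} \<subseteq> {z \<in> S. \<bar>F i x - F i z\<bar> < e}"
      if "\<bar>F i x - F i z\<bar> < e" for z
      using that \<open>i \<in> I\<close>
      by (intro exI[of _ "{i}"] exI[of _ "e - \<bar>F i x - F i z\<bar>"]) (auto simp: real_entourage_def)
    then show ?thesis unfolding opF by auto
  qed
  show "Hausdorff_space (fst X)"
    unfolding Hausdorff_space_def S_def[symmetric]
  proof (intro allI impI)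
    fix x y assume xy: "x \<in> S \<and> y \<in> S \<and> x \<noteq> y"
    then obtain i where i: "i \<in> I" "F i x \<noteq> F i y" using sepF by blast
    define e where "e = \<bar>F i x - F i y\<bar> / 2"
    have "disjnt {z \<in> S. \<bar>F i x - F i z\<bar> < e} {z \<in> S. \<bar>F i y - F i z\<bar> < e}"
      unfolding disjnt_iff e_def by (auto simp: field_simps abs_if split: if_splits)
    moreover have "e > 0" using i unfolding e_def by simp
    ultimately show "\<exists>U V. openin (fst X) U \<and> openin (fst X) V \<and> x \<in> U \<and> y \<in> V \<and> disjnt U V"
      using op[OF i(1)] xy
      by (intro exI[of _ "{z \<in> S. \<bar>F i x - F i z\<bar> < e}"] exI[of _ "{z \<in> S. \<bar>F i y - F i z\<bar> < e}"])
         auto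
  qed
qed

text \<open>
  Each uniformly continuous function is its own index, which is why index sets of type
  \<open>'a \<Rightarrow> real\<close> are enough.
\<close>

lemma real_coordinates_if_Hausdorff_uniformizable:
  fixes X :: "'a born_univ"
  assumes H: "Hausdorff_space (fst X)" and "uniformizable X"
  shows "\<exists>I :: ('a \<Rightarrow> real) set. real_coordinates I (\<lambda>f. f) X"
proof -
  define S where "S = topspace (fst X)"
  obtain \<U> where U: "uniformity_on S \<U>" and top: "uniform_topology S \<U> = fst X"
    and born: "snd X = {B. bourbaki_bounded S \<U> B}"
    using \<open>uniformizable X\<close> unfolding uniformizable_def S_def by (elim exE conjE)
  define I where "I = {f. uniformly_continuous_real S \<U> f}"
  have op: "openin (fst X) A \<longleftrightarrow> A \<subseteq> S \<and> (\<forall>x\<in>A. \<exists>U\<in>\<U>. U `` {x} \<subseteq> A)" for A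
    using openin_uniform_topology[OF U] top by metis
  have sep: "\<exists>f\<in>I. f x = 0 \<and> (\<forall>y. (x, y) \<notin> V \<longrightarrow> f y = 1)" if "V \<in> \<U>" "x \<in> S" for V x
  proof -
    obtain h where h: "\<And>A x. x \<in> A \<Longrightarrow> x \<in> S \<Longrightarrow> h A x = 0"
      "\<And>A x. x \<notin> V `` A \<Longrightarrow> h A x = 1"
      "\<And>e. e > 0 \<Longrightarrow> \<exists>W\<in>\<U>. \<forall>(x, y)\<in>W. \<forall>A. \<bar>h A x - h A y\<bar> < (e::real)"
      by (rule uniform_urysohn[OF U \<open>V \<in> \<U>\<close>]) blast
    have "h {x} \<in> I" unfolding I_def uniformly_continuous_real_def using h(3) by fast
    moreover have "h {x} x = 0" using h(1) \<open>x \<in> S\<close> by simp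
    moreover have "\<forall>y. (x, y) \<notin> V \<longrightarrow> h {x} y = 1" using h(2) by auto
    ultimately show ?thesis by blast
  qed
  have "real_coordinates I (\<lambda>f. f) X"
    unfolding real_coordinates_def S_def[symmetric]
  proof (intro conjI allI ballI impI)
    fix x y assume xy: "x \<in> S" "y \<in> S" "\<forall>f\<in>I. f x = f y"
    show "x = y"
    proof (rule ccontr)
      assume "x \<noteq> y"
      then obtain G where "openin (fst X) G" "x \<in> G" "y \<notin> G"
        using H xy unfolding Hausdorff_space_def S_def disjnt_iff by meson
      then obtain V where V: "V \<in> \<U>" "(x, y) \<notin> V" unfolding op by blast
      obtain f where "f \<in> I" "f x = 0" "f y = 1" using sep[OF V(1) xy(1)] V(2) by blast
      then show False using xy(3) by force
    qed
  next
    fix A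
    have "(\<exists>V\<in>\<U>. V `` {x} \<subseteq> A) \<longleftrightarrow> (\<exists>J e. finite J \<and> J \<subseteq> I \<and> e > 0 \<and>
        real_entourage S (\<lambda>f. f) J e `` {x} \<subseteq> A)" if "x \<in> S" for x
    proof
      assume "\<exists>V\<in>\<U>. V `` {x} \<subseteq> A"
      then obtain V where V: "V \<in> \<U>" "V `` {x} \<subseteq> A" by blast
      obtain f where f: "f \<in> I" "f x = 0" "\<And>y. (x, y) \<notin> V \<Longrightarrow> f y = 1"
        using sep[OF V(1) \<open>x \<in> S\<close>] by blast
      have "real_entourage S (\<lambda>f. f) {f} 1 `` {x} \<subseteq> A"
        using f(2,3) V(2) unfolding real_entourage_def by force
      then show "\<exists>J e. finite J \<and> J \<subseteq> I \<and> e > 0 \<and>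
          real_entourage S (\<lambda>f. f) J e `` {x} \<subseteq> A"
        using f(1) by (intro exI[of _ "{f}"] exI[of _ 1]) auto
    next
      assume "\<exists>J e. finite J \<and> J \<subseteq> I \<and> e > 0 \<and> real_entourage S (\<lambda>f. f) J e `` {x} \<subseteq> A"
      then obtain J e where J: "finite J" "J \<subseteq> I" "e > 0"
        "real_entourage S (\<lambda>f. f) J e `` {x} \<subseteq> A" by blast
      have "real_entourage S (\<lambda>f. f) J e \<in> \<U>"
        using J(2) by (intro real_entourage_in_uniformity[OF U J(1,3)]) (auto simp: I_def)
      then show "\<exists>V\<in>\<U>. V `` {x} \<subseteq> A" using J(4) by blast
    qed
    then show "openin (fst X) A \<longleftrightarrow> A \<subseteq> S \<and> (\<forall>x\<in>A. \<exists>J e. finite J \<and> J \<subseteq> I \<and> e > 0 \<and>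
        real_entourage S (\<lambda>f. f) J e `` {x} \<subseteq> A)"
      unfolding op by (meson subsetD)
  next
    fix B
    show "B \<in> snd X \<longleftrightarrow> B \<subseteq> S \<and> (\<forall>f\<in>I. bounded (f ` B))"
    proof
      assume "B \<in> snd X"
      then have B: "bourbaki_bounded S \<U> B" using born by simp
      then show "B \<subseteq> S \<and> (\<forall>f\<in>I. bounded (f ` B))"
        using bounded_image_of_bourbaki_bounded[OF U B]
        unfolding I_def bourbaki_bounded_def by simp
    next
      assume "B \<subseteq> S \<and> (\<forall>f\<in>I. bounded (f ` B))"
      then have "bourbaki_bounded S \<U> B"
        using unbounded_uniformly_continuous_function[OF U, of B] unfolding I_def by blast
      then show "B \<in> snd X" using born by simp
    qed
  qed
  then show ?thesis by blast
qed

theorem proposition11: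
  fixes X :: "'a topology" and \<B> :: "'a set set"
  assumes "bornological_universe (X, \<B>)"
  shows "(Hausdorff_space X \<and> uniformizable (X, \<B>) \<longleftrightarrow>
            iso_to_subspace_of_real_lines TYPE('a \<Rightarrow> real) (X, \<B>)) \<and>
         (iso_to_subspace_of_real_lines TYPE('i) (X, \<B>) \<longrightarrow>
            Hausdorff_space X \<and> uniformizable (X, \<B>))"
  unfolding iso_to_subspace_iff_real_coordinates[OF assms]
proof (intro conjI iffI impI)
  assume "Hausdorff_space X \<and> uniformizable (X, \<B>)"
  then have "\<exists>I :: ('a \<Rightarrow> real) set. real_coordinates I (\<lambda>f. f) (X, \<B>)"
    by (intro real_coordinates_if_Hausdorff_uniformizable) auto
  then show "\<exists>(I :: ('a \<Rightarrow> real) set) F. real_coordinates I F (X, \<B>)" by blast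
qed (auto dest: Hausdorff_uniformizable_if_real_coordinates)

end
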